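(* For every positive integer $n$, the set of monomials $B_n^{(1,2)}$ has cardinality $2^{n-1}\, n!$.
   Context: A modified Motzkin path of length $n$ is a lattice path $\pi=(p_1,\ldots,p_n)$ in $\mathbb{Z}^2$ starting at $(0,0)$ whose $i$-th step $p_i$ is one of: an (undecorated) up-step $(1,1)$; a horizontal step $(1,0)$ with decoration $\theta_i$; a horizontal step $(1,0)$ with decoration $\xi_i$; a down-step $(1,-1)$ with decoration $\theta_i\xi_i$; such that the first step is an up-step and afterwards the path never goes below the line $y=1$. The set of these paths is $\Pi(n)_{>0}$. For $\pi\in\Pi(n)_{>0}$ let $T(\pi)$ (resp. $S(\pi)$) be the set of indices $i$ such that $\theta_i$ (resp. $\xi_i$) occurs in the decoration of $p_i$; both are subsets of $\{2,\ldots,n\}$. For $T,S\subseteq\{2,\ldots,n\}$ define $\alpha(T,S)=(\alpha_1(T,S),\ldots,\alpha_n(T,S))$ by $\alpha_1(T,S)=0$ and, for $2\le i\le n$, $\alpha_i(T,S)=\alpha_{i-1}(T,S)-1+\chi(i\notin T)+\chi(i\notin S)$, where $\chi(P)=1$ if $P$ is true and $0$ otherwise. The variables $x_1,\dots,x_n$ commute with all variables; the variables $\theta_1,\ldots,\theta_n,\xi_1,\ldots,\xi_n$ anticommute with one another (so $\theta_i^2=\xi_i^2=0$). For $T=\{t_1<\cdots<t_k\}$, $\theta_T=\theta_{t_1}\cdots\theta_{t_k}$, and similarly $\xi_S$; $x^\alpha=x_1^{\alpha_1}\cdots x_n^{\alpha_n}$. Then $B_n^{(1,2)}$ is the set of monomials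 $x^\alpha\theta_T\xi_S$ such that $(T,S)=(T(\pi),S(\pi))$ for some $\pi\in\Pi(n)_{>0}$ and $0\le\alpha_i\le\alpha_i(T,S)$ for all $i\in\{1,\ldots,n\}$. (Signs of monomials are irrelevant; an element of $B_n^{(1,2)}$ is determined by the triple $(\alpha,T,S)$.) *)

theory Defs
  imports Complex_Main "HOL-Library.Product_Plus"
begin

text \<open>The steps of modified Motzkin paths. The index of the decorating variables is the position
  of the step in the path, so only the kind of the decoration is recorded: \<open>Up\<close> is undecorated,
  \<open>Level_theta\<close> and \<open>Level_xi\<close> are the two horizontal steps, and \<open>Down\<close> carries both a
  \<open>\<theta>\<close> and a \<open>\<xi>\<close>.\<close>

datatype motzkin_step = Up | Level_theta | Level_xi | Down

fun step_vector :: "motzkin_step \<Rightarrow> int \<times> int" where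
  "step_vector Up = (1, 1)"
| "step_vector Level_theta = (1, 0)"
| "step_vector Level_xi = (1, 0)"
| "step_vector Down = (1, -1)"

fun has_theta :: "motzkin_step \<Rightarrow> bool" where
  "has_theta Up = False"
| "has_theta Level_theta = True"
| "has_theta Level_xi = False"
| "has_theta Down = True"

fun has_xi :: "motzkin_step \<Rightarrow> bool" where
  "has_xi Up = False"
| "has_xi Level_theta = False"
| "has_xi Level_xi = True"
| "has_xi Down = True"

text \<open>A path is the list of its steps; since lists are indexed from 0, the \<open>i\<close>-th step of \<open>p\<close>
  is \<open>p ! (i - 1)\<close>.\<close>

definition path_point :: "motzkin_step list \<Rightarrow> nat \<Rightarrow> int \<times> int" where
  "path_point p k = (\<Sum>i\<in>{1..k}. step_vector (p ! (i - 1)))"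

text \<open>The set \<open>\<Pi>(n)\<^sub>>\<^sub>0\<close>. Steps are straight segments, so it suffices to bound the lattice points
  of the path.\<close>

definition motzkin_paths_pos :: "nat \<Rightarrow> motzkin_step list set" where
  "motzkin_paths_pos n = {p. length p = n \<and> p ! 0 = Up \<and> (\<forall>k\<in>{1..n}. snd (path_point p k) \<ge> 1)}"

definition theta_set :: "motzkin_step list \<Rightarrow> nat set" where
  "theta_set p = {i\<in>{1..length p}. has_theta (p ! (i - 1))}"

definition xi_set :: "motzkin_step list \<Rightarrow> nat set" where
  "xi_set p = {i\<in>{1..length p}. has_xi (p ! (i - 1))}"

text \<open>The exponents \<open>\<alpha>\<^sub>i(T,S)\<close> are integers, as they can be negative for arbitrary \<open>T\<close> and \<open>S\<close>.
  The value at the index 0 is a dummy.\<close>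

fun max_exponent :: "nat set \<Rightarrow> nat set \<Rightarrow> nat \<Rightarrow> int" where
  "max_exponent T S 0 = 0"
| "max_exponent T S (Suc 0) = 0"
| "max_exponent T S (Suc (Suc k)) =
     max_exponent T S (Suc k) - 1 + of_bool (Suc (Suc k) \<notin> T) + of_bool (Suc (Suc k) \<notin> S)"

text \<open>The monomial \<open>x\<^sup>\<alpha> \<theta>\<^sub>T \<xi>\<^sub>S\<close>, up to sign, is represented by the triple \<open>(\<alpha>, T, S)\<close>.
  An exponent vector \<open>\<alpha>\<close> is a function that vanishes outside \<open>{1..n}\<close>, so that distinct functions
  give distinct monomials.\<close>

type_synonym super_monomial = "(nat \<Rightarrow> nat) \<times> nat set \<times> nat set"

definition basis_1_2 :: "nat \<Rightarrow> super_monomial set" where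
  "basis_1_2 n = {(\<alpha>, T, S).
     (\<exists>p\<in>motzkin_paths_pos n. T = theta_set p \<and> S = xi_set p) \<and>
     (\<forall>i\<in>{1..n}. int (\<alpha> i) \<le> max_exponent T S i) \<and>
     (\<forall>i. i \<notin> {1..n} \<longrightarrow> \<alpha> i = 0)}"

end

(* The number of admissible exponent vectors of a path is the product of its heights, so the
   cardinality is a weighted path count. Let W(m,h) be the weight of all continuations by m steps
   from height h. The recurrence
     W(m+1,h) = (h+1) W(m,h+1) + 2h W(m,h) + (h-1) W(m,h-1)
   is solved by the exponential generating function (1+2t)^(h-1) / (1-2t)^(h+1), which for h = 1
   is 1 / (1-2t)^2 and gives W(n-1,1) = 2^(n-1) n!. *)

theory Submission
  imports Defs "HOL-Computational_Algebra.Formal_Power_Series"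
begin

lemma path_point_Suc: "path_point p (Suc k) = path_point p k + step_vector (p ! k)"
  by (simp add: path_point_def)

lemma path_point_Cons: "path_point (s # q) (Suc k) = step_vector s + path_point q k"
  by (induction k) (simp_all add: path_point_def)

text \<open>Each step changes both quantities by 1 minus its number of decorations; the initial
  up-step fixes the offset. Hence a point at height y leaves exactly y choices for its
  exponent.\<close>

lemma max_exponent_eq_height:
  assumes "p ! 0 = Up" "Suc k \<le> length p"
  shows "max_exponent (theta_set p) (xi_set p) (Suc k) = snd (path_point p (Suc k)) - 1"
  using assms(2)
proof (induction k)
  case 0
  then show ?case using assms(1) by (simp add: path_point_def)
next
  case (Suc k)
  then show ?case
    by (cases "p ! Suc k") (simp_all add: path_point_Suc[of p "Suc k"] theta_set_def xi_set_def)
qed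

lemma motzkin_step_eqI:
  "has_theta s = has_theta t \<Longrightarrow> has_xi s = has_xi t \<Longrightarrow> s = t"
  by (cases s; cases t) simp_all

text \<open>The two decoration flags determine a step, so distinct paths contribute disjoint sets of
  monomials.\<close>

lemma path_eqI:
  assumes "length p = length q" "theta_set p = theta_set q" "xi_set p = xi_set q"
  shows "p = q"
proof (rule nth_equalityI)
  fix i assume i: "i < length p"
  have "Suc i \<in> theta_set p \<longleftrightarrow> Suc i \<in> theta_set q" "Suc i \<in> xi_set p \<longleftrightarrow> Suc i \<in> xi_set q"
    using assms by simp_all
  then show "p ! i = q ! i"
    using i assms(1) by (intro motzkin_step_eqI) (simp_all add: theta_set_def xi_set_def)
qed (fact assms)

lemma prod_1_to_Suc_shift:
  fixes f :: "nat \<Rightarrow> 'a :: comm_monoid_mult"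
  shows "(\<Prod>k\<in>{1..Suc m}. f k) = f 1 * (\<Prod>k\<in>{1..m}. f (Suc k))"
  unfolding One_nat_def prod.atLeast1_atMost_eq prod.lessThan_Suc_shift ..

lemma UNIV_motzkin_step: "UNIV = {Up, Level_theta, Level_xi, Down}"
  using motzkin_step.exhaust by auto

lemma finite_steps_length_eq: "finite {q :: motzkin_step list. length q = m}"
proof -
  have "finite (UNIV :: motzkin_step set)" by (simp add: UNIV_motzkin_step)
  from finite_lists_length_eq[OF this, of m] show ?thesis by simp
qed

lemma sum_steps_length_Suc:
  fixes f :: "motzkin_step list \<Rightarrow> 'a :: comm_monoid_add"
  shows "(\<Sum>q | length q = Suc m. f q) = (\<Sum>s\<in>UNIV. \<Sum>q | length q = m. f (s # q))"
proof -
  have "(\<Sum>q | length q = Suc m. f q) = (\<Sum>(s, q)\<in>UNIV \<times> {q. length q = m}. f (s # q))"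
    by (rule sum.reindex_bij_witness[of _ "\<lambda>(s, q). s # q" "\<lambda>q. (hd q, tl q)"])
      (auto simp: length_Suc_conv)
  then show ?thesis by (simp add: sum.cartesian_product)
qed

definition exponent_vectors :: "nat \<Rightarrow> (nat \<Rightarrow> int) \<Rightarrow> (nat \<Rightarrow> nat) set" where
  "exponent_vectors n M = {\<alpha>. (\<forall>i\<in>{1..n}. int (\<alpha> i) \<le> M i) \<and> (\<forall>i. i \<notin> {1..n} \<longrightarrow> \<alpha> i = 0)}"

text \<open>Both sides are boxes; they differ only in the default value outside
  \<open>{1..n}\<close>, 0 against \<open>undefined\<close>.\<close>

lemma exponent_vectors_bij:
  "bij_betw (\<lambda>\<alpha>. restrict \<alpha> {1..n}) (exponent_vectors n M)
     (\<Pi>\<^sub>E i\<in>{1..n}. {..<nat (M i + 1)})"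
  by (rule bij_betw_byWitness[where f' = "\<lambda>f i. if i \<in> {1..n} then f i else 0"])
    (force simp: exponent_vectors_def PiE_def extensional_def fun_eq_iff Pi_def zless_nat_eq_int_zless)+

lemma finite_exponent_vectors: "finite (exponent_vectors n M)"
  using bij_betw_finite[OF exponent_vectors_bij, of n M] by (simp add: finite_PiE)

text \<open>A negative bound \<open>M i\<close> leaves no vector, and \<open>nat\<close> then turns
  its factor into 0.\<close>

lemma card_exponent_vectors: "card (exponent_vectors n M) = (\<Prod>i\<in>{1..n}. nat (M i + 1))"
  using bij_betw_same_card[OF exponent_vectors_bij, of n M] by (simp add: card_PiE)

text \<open>The factors are the heights after each step, without the starting height
  \<open>h\<close>. Through \<open>nat\<close>, a continuation that reaches height 0 or below has
  weight 0.\<close>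

definition continuation_weight :: "nat \<Rightarrow> int \<Rightarrow> nat" where
  "continuation_weight m h =
     (\<Sum>q | length q = m. \<Prod>k\<in>{1..m}. nat (h + snd (path_point q k)))"

lemma continuation_weight_0: "continuation_weight 0 h = 1"
  by (simp add: continuation_weight_def)

lemma continuation_weight_Suc:
  "continuation_weight (Suc m) h =
     (\<Sum>s\<in>UNIV. nat (h + snd (step_vector s)) * continuation_weight m (h + snd (step_vector s)))"
proof -
  have "(\<Prod>k\<in>{1..Suc m}. nat (h + snd (path_point (s # q) k))) =
      nat (h + snd (step_vector s)) *
      (\<Prod>k\<in>{1..m}. nat (h + snd (step_vector s) + snd (path_point q k)))" for s q
    unfolding prod_1_to_Suc_shift unfolding One_nat_def path_point_Cons
    by (simp add: path_point_def[of _ 0] add.assoc)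
  then show ?thesis
    unfolding continuation_weight_def sum_steps_length_Suc
    by (simp add: sum_distrib_left)
qed

text \<open>The last summand vanishes for \<open>k = 0\<close>, so paths leaving the region \<open>y \<ge> 1\<close> need no special
  treatment.\<close>

lemma continuation_weight_rec:
  "continuation_weight (Suc m) (int k + 1) =
     (k + 2) * continuation_weight m (int k + 2) + 2 * (k + 1) * continuation_weight m (int k + 1) +
     k * continuation_weight m (int k)"
  by (simp add: continuation_weight_Suc UNIV_motzkin_step nat_add_distrib add.assoc)

text \<open>The generating function for starting height \<open>k + 1\<close>, with
  \<open>fps_X\<close> standing for 2t to clear the powers of 2.\<close>

definition height_fps :: "nat \<Rightarrow> real fps" where
  "height_fps k = (1 + fps_X) ^ k * inverse (1 - fps_X) ^ (k + 2)"

lemma fps_deriv_inverse_one_minus_X: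
  "fps_deriv (inverse (1 - fps_X :: real fps)) = inverse (1 - fps_X) ^ 2"
  by (simp add: fps_inverse_deriv)

text \<open>Write 1 + X as 2 - (1 - X).\<close>

lemma one_plus_X_times_inverse:
  "(1 + fps_X) * inverse (1 - fps_X) = 2 * inverse (1 - fps_X :: real fps) - 1"
proof -
  have "(1 - fps_X) * inverse (1 - fps_X :: real fps) = 1"
    by (rule inverse_mult_eq_1') simp
  then show ?thesis by (simp add: algebra_simps)
qed

text \<open>The differential form of the weight recurrence; the factor 2 is the chain rule for X =
  2t. At \<open>k = 0\<close> the truncated index \<open>k - 1\<close> is harmless, its coefficient
  being 0.\<close>

lemma fps_deriv_height_fps:
  "2 * fps_deriv (height_fps k) = of_nat (k + 2) * height_fps (Suc k) +
     of_nat (2 * (k + 1)) * height_fps k + of_nat k * height_fps (k - 1)"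
proof -
  define a u where "a = (1 + fps_X :: real fps)" and "u = inverse (1 - fps_X :: real fps)"
  have au: "a * u = 2 * u - 1"
    unfolding a_def u_def by (rule one_plus_X_times_inverse)
  have du: "fps_deriv u = u ^ 2"
    unfolding u_def by (rule fps_deriv_inverse_one_minus_X)
  have da: "fps_deriv a = 1" by (simp add: a_def)
  have H: "height_fps j = a ^ j * u ^ (j + 2)" for j
    by (simp add: height_fps_def a_def u_def)
  show ?thesis
  proof (cases k)
    case 0
    have "2 * (2 * u * u ^ 2) = 2 * (a * u) * u ^ 2 + 2 * u ^ 2"
      unfolding au by (simp add: algebra_simps power2_eq_square)
    then show ?thesis
      by (simp add: 0 H du algebra_simps power2_eq_square)
  next
    case (Suc j)
    define c :: "real fps" where "c = of_nat j"
    have "2 * fps_deriv (height_fps k) =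
        a ^ j * u ^ (j + 2) * (2 * (c + 1) * u + 2 * (c + 3) * (a * u) * u)"
      unfolding Suc H fps_deriv_mult fps_deriv_power' da du
      by (simp add: c_def algebra_simps power2_eq_square)
    \<comment> \<open>With the common factor \<open>a ^ j * u ^ (j + 2)\<close> removed, the series
      at \<open>k + 1\<close>, \<open>k\<close>, \<open>k - 1\<close> become (au)^2, au and 1.
      Substituting au = 2u - 1 leaves a polynomial identity in u.\<close>
    also have "2 * (c + 1) * u + 2 * (c + 3) * (a * u) * u =
        (c + 3) * (a * u) * (a * u) + 2 * (c + 2) * (a * u) + (c + 1)"
      unfolding au by (simp add: algebra_simps)
    also have "a ^ j * u ^ (j + 2) * \<dots> = of_nat (k + 2) * height_fps (Suc k) +
        of_nat (2 * (k + 1)) * height_fps k + of_nat k * height_fps (k - 1)"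
      unfolding Suc H by (simp add: c_def algebra_simps power2_eq_square)
    finally show ?thesis .
  qed
qed

lemma height_fps_nth_Suc:
  "2 * real (Suc m) * fps_nth (height_fps k) (Suc m) = real (k + 2) * fps_nth (height_fps (Suc k)) m +
     real (2 * (k + 1)) * fps_nth (height_fps k) m + real k * fps_nth (height_fps (k - 1)) m"
proof -
  have "fps_nth (2 * fps_deriv (height_fps k)) m = 2 * real (Suc m) * fps_nth (height_fps k) (Suc m)"
    by (simp add: numeral_fps_const)
  then show ?thesis
    unfolding fps_deriv_height_fps by (simp flip: fps_of_nat del: of_nat_Suc of_nat_add of_nat_mult)
qed

text \<open>The factor \<open>fact m * 2 ^ m\<close> converts the coefficient recurrence into that
  of the weights. Steps change the height, so the induction covers all \<open>k\<close> at
  once.\<close>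

lemma continuation_weight_eq:
  "real (continuation_weight m (int k + 1)) = fact m * 2 ^ m * fps_nth (height_fps k) m"
proof (induction m arbitrary: k)
  case 0
  then show ?case
    by (simp add: continuation_weight_0 height_fps_def fps_nth_power_0)
next
  case (Suc m)
  \<comment> \<open>For \<open>k = 0\<close> the induction hypothesis says nothing about height 0,
    but the factor \<open>k\<close> makes both sides vanish.\<close>
  have down: "real (k * continuation_weight m (int k)) =
      fact m * 2 ^ m * (real k * fps_nth (height_fps (k - 1)) m)"
  proof (cases k)
    case (Suc j)
    then show ?thesis using Suc.IH[of j] by (simp add: algebra_simps)
  qed simp
  have up: "real (continuation_weight m (int k + 2)) = fact m * 2 ^ m * fps_nth (height_fps (Suc k)) m"
    using Suc.IH[of "Suc k"] by (simp add: algebra_simps)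
  have level: "real (continuation_weight m (int k + 1)) = fact m * 2 ^ m * fps_nth (height_fps k) m"
    by (rule Suc.IH)
  have "real (continuation_weight (Suc m) (int k + 1)) =
      fact m * 2 ^ m * (real (k + 2) * fps_nth (height_fps (Suc k)) m +
        real (2 * (k + 1)) * fps_nth (height_fps k) m + real k * fps_nth (height_fps (k - 1)) m)"
    unfolding continuation_weight_rec of_nat_add[of "_ + _"] down
    unfolding of_nat_add[of "_ * _"] of_nat_mult[of _ "continuation_weight _ _"] up level
    by (simp only: distrib_left mult.assoc mult.left_commute)
  also have "\<dots> = fact m * 2 ^ m * (2 * real (Suc m) * fps_nth (height_fps k) (Suc m))"
    unfolding height_fps_nth_Suc ..
  finally show ?case by (simp add: algebra_simps)
qed

text \<open>The series 1/(1 - X)^2 is the derivative of the geometric series.\<close>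

lemma height_fps_0_nth: "fps_nth (height_fps 0) m = real (m + 1)"
proof -
  have "fps_nth (fps_deriv (inverse (1 - fps_X :: real fps))) m = real (m + 1)"
    by (simp add: fps_inverse_one_minus_fps_X)
  then show ?thesis
    by (simp add: height_fps_def fps_deriv_inverse_one_minus_X power2_eq_square)
qed

lemma continuation_weight_1: "continuation_weight m 1 = 2 ^ m * fact (Suc m)"
proof -
  have "real (continuation_weight m 1) = real (2 ^ m * fact (Suc m))"
    using continuation_weight_eq[of m 0] by (simp add: height_fps_0_nth algebra_simps)
  then show ?thesis by (simp only: of_nat_eq_iff)
qed

text \<open>Positivity of the path may be dropped: a path that violates it admits no exponent vector.\<close>

lemma basis_1_2_bij:
  assumes "n \<ge> 1"
  shows "bij_betw (\<lambda>(p, \<alpha>). (\<alpha>, theta_set p, xi_set p))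
    (SIGMA p:{p. length p = n \<and> p ! 0 = Up}. exponent_vectors n (\<lambda>i. snd (path_point p i) - 1))
    (basis_1_2 n)"
proof -
  have M: "max_exponent (theta_set p) (xi_set p) i = snd (path_point p i) - 1"
    if "length p = n" "p ! 0 = Up" "i \<in> {1..n}" for p i
    using that max_exponent_eq_height[of p "i - 1"] by auto
  have "p \<in> motzkin_paths_pos n"
    if "length p = n" "p ! 0 = Up" "\<alpha> \<in> exponent_vectors n (\<lambda>i. snd (path_point p i) - 1)" for p \<alpha>
    using that by (force simp: motzkin_paths_pos_def exponent_vectors_def)
  then show ?thesis
    unfolding bij_betw_def
    by (intro conjI)
      (auto simp: inj_on_def basis_1_2_def exponent_vectors_def motzkin_paths_pos_def M image_iff
        intro: path_eqI)
qed

theorem theorem3p7: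
  fixes n :: nat
  assumes "n \<ge> 1"
  shows "card (basis_1_2 n) = 2 ^ (n - 1) * fact n"
proof -
  obtain m where n: "n = Suc m" using assms by (cases n) auto
  let ?A = "{p. length p = n \<and> p ! 0 = Up}"
  have fin: "finite ?A"
    by (rule finite_subset[OF _ finite_steps_length_eq[of n]]) auto
  have "card (basis_1_2 n) = (\<Sum>p\<in>?A. \<Prod>i\<in>{1..n}. nat (snd (path_point p i)))"
    using bij_betw_same_card[OF basis_1_2_bij[OF assms]]
    by (simp add: card_SigmaI fin finite_exponent_vectors card_exponent_vectors)
  also have "\<dots> = (\<Sum>q | length q = m. \<Prod>i\<in>{1..n}. nat (snd (path_point (Up # q) i)))"
    by (rule sum.reindex_bij_witness[of _ "\<lambda>q. Up # q" tl]) (auto simp: n length_Suc_conv)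
  also have "\<dots> = continuation_weight m 1"
    unfolding continuation_weight_def
  proof (rule sum.cong)
    fix q :: "motzkin_step list"
    show "(\<Prod>i\<in>{1..n}. nat (snd (path_point (Up # q) i))) =
        (\<Prod>k\<in>{1..m}. nat (1 + snd (path_point q k)))"
      \<comment> \<open>The forced up-step contributes the factor 1 and raises all later heights by
        1.\<close>
      unfolding n prod_1_to_Suc_shift unfolding One_nat_def path_point_Cons
      by (simp add: path_point_def[of _ 0])
  qed simp
  finally show ?thesis
    by (simp add: continuation_weight_1 n)
qed

end
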